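(* If $f:\mathbb{D}\to\mathbb{C}$ is outer and $\phi:\mathbb{D}\to\mathbb{D}$ is holomorphic, then $f\circ\phi$ is outer.
   Context: $\mathbb{D}$ is the open unit disk in $\mathbb{C}$ and $\mathbb{T}$ is the unit circle. A holomorphic function $g:\mathbb{D}\to\mathbb{C}$ is called outer if it has the form \[ g(z)=c\exp\Bigl(\int_{\mathbb{T}} \frac{e^{i\theta}+z}{e^{i\theta}-z}\log\rho(e^{i\theta})\,\frac{d\theta}{2\pi}\Bigr)\quad(z\in\mathbb{D}), \] where $c$ is a unimodular constant and $\rho:\mathbb{T}\to\mathbb{R}^+$ is a function such that $\log\rho\in L^1(\mathbb{T})$. *)

theory Defs
  imports "HOL-Complex_Analysis.Complex_Analysis"
begin

text \<open>
  The unit disk is \<open>ball 0 1\<close> and the unit circle is \<open>sphere 0 1\<close>. Functions on either are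
  total functions whose values elsewhere are irrelevant. The unit circle is parametrised by
  \<open>\<theta> \<mapsto> cis \<theta>\<close> on \<open>{0..2 * pi}\<close> with Lebesgue measure; the endpoints overlap only in a null set.
\<close>

definition outer :: "(complex \<Rightarrow> complex) \<Rightarrow> bool" where
  "outer g \<longleftrightarrow>
     g holomorphic_on ball 0 1 \<and>
     (\<exists>(c :: complex) (\<rho> :: complex \<Rightarrow> real).
        norm c = 1 \<and>
        (\<forall>\<zeta> \<in> sphere 0 1. \<rho> \<zeta> > 0) \<and>
        set_integrable lebesgue {0..2 * pi} (\<lambda>\<theta>. ln (\<rho> (cis \<theta>))) \<and>
        (\<forall>z \<in> ball 0 1.
           g z = c * exp ((LINT \<theta>:{0..2 * pi}|lebesgue.
                             (cis \<theta> + z) / (cis \<theta> - z) * of_real (ln (\<rho> (cis \<theta>)))) / (2 * pi))))"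

end

theory Submission
  imports Defs
begin

text \<open>
  Write \<open>H u\<close> for the Schwarz integral \<open>schwarz u\<close> of a real function \<open>u\<close> on the circle. Its real
  part is the Poisson integral of \<open>u\<close>, and a function is outer precisely when it is a unimodular
  constant times \<open>exp (H u)\<close> with \<open>u\<close> integrable (\<open>outer_iff_schwarz\<close>). So it has to be shown that
  \<open>h = H u \<circ> \<phi>\<close> is again of the form \<open>H v\<close> up to an imaginary constant: the exponential of that
  constant is unimodular and is absorbed into the factor.

  On each circle of radius \<open>r < 1\<close>, Cauchy's formula recovers \<open>h\<close> inside from the boundary values of
  its real part (\<open>schwarz_formula\<close>). If the functions \<open>\<theta> \<mapsto> Re (h (r cis \<theta>))\<close> converge in \<open>L\<^sup>1\<close> as
  \<open>r\<close> tends to 1, the limit is the required \<open>v\<close> (\<open>schwarz_representation\<close>). Boundedness in \<open>L\<^sup>1\<close>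
  would not suffice, since the limit could then be a singular measure.

  Convergence is proved first for bounded \<open>u\<close>, where \<open>Re h\<close> is bounded by the maximum principle
  built into the positive Poisson kernel. By Parseval, the inner product of the real parts of two
  dilates of \<open>h\<close>, with radii \<open>r\<close> and \<open>s\<close>, is \<open>C (r s)\<close> for an increasing function \<open>C\<close>
  (\<open>dilate_correlation\<close>). As \<open>C\<close> is bounded, it has a limit at 1, and the squared \<open>L\<^sup>2\<close> distance
  \<open>C (r\<^sup>2) + C (s\<^sup>2) - 2 C (r s)\<close> of the two dilates tends to 0.

  A general \<open>u\<close> is approximated in \<open>L\<^sup>1\<close> by bounded functions \<open>u'\<close>. Positivity of the Poisson kernel
  and the mean value property show that composition with \<open>\<phi>\<close> preserves the approximation uniformly
  in \<open>r\<close>: the \<open>L\<^sup>1\<close> distance of the two compositions on every circle is at most \<open>2\<pi>\<close> times the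
  Poisson integral of \<open>\<bar>u - u'\<bar>\<close> at the single point \<open>\<phi> 0\<close>
  (\<open>schwarz_compose_dilates_L1_Cauchy\<close>).
\<close>

section \<open>Integrals over the circle\<close>

abbreviation angles :: "real measure"
  where "angles \<equiv> lebesgue_on {0..2 * pi}"

definition schwarz :: "(real \<Rightarrow> real) \<Rightarrow> complex \<Rightarrow> complex" where
  "schwarz u z =
     (\<integral>\<theta>. (cis \<theta> + z) / (cis \<theta> - z) * of_real (u \<theta>) \<partial>angles) / (2 * pi)"

lemma cis_neq_interior: "z \<in> ball 0 1 \<Longrightarrow> cis \<theta> \<noteq> z"
  by auto

lemma kernel_bound:
  assumes "z \<in> ball 0 1"
  shows "norm ((cis \<theta> + z) / (cis \<theta> - z)) \<le> (1 + norm z) / (1 - norm z)"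
proof -
  have "norm (cis \<theta> + z) \<le> 1 + norm z"
    using norm_triangle_ineq[of "cis \<theta>" z] by simp
  moreover have "1 - norm z \<le> norm (cis \<theta> - z)"
    using norm_triangle_ineq2[of "cis \<theta>" z] by simp
  ultimately show ?thesis
    using assms by (auto simp: norm_divide intro!: frac_le)
qed

text \<open>
  The real part is the Poisson kernel \<open>(1 - \<bar>z\<bar>\<^sup>2) / \<bar>cis \<theta> - z\<bar>\<^sup>2\<close>.
\<close>

lemma kernel_Re_nonneg:
  assumes "z \<in> ball 0 1"
  shows "0 \<le> Re ((cis \<theta> + z) / (cis \<theta> - z))"
proof -
  have "Re ((cis \<theta> + z) * cnj (cis \<theta> - z)) = norm (cis \<theta>) ^ 2 - norm z ^ 2"
    by (simp only: cmod_power2) (simp add: algebra_simps power2_eq_square)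
  also have "\<dots> \<ge> 0"
    using assms by (simp add: power_le_one)
  finally show ?thesis
    by (subst complex_div_cnj) (simp add: Re_divide_of_real flip: of_real_power)
qed

lemma continuous_cis_kernel:
  "z \<in> ball 0 1 \<Longrightarrow> continuous_on A (\<lambda>\<theta>. (cis \<theta> + z) / (cis \<theta> - z))"
  using cis_neq_interior by (auto intro!: continuous_intros)

lemma integrable_angles_continuous:
  fixes F :: "real \<Rightarrow> 'b :: euclidean_space"
  assumes "continuous_on {0..2 * pi} F"
  shows "integrable angles F"
  using assms by (rule continuous_imp_integrable_real)

lemma integrable_angles_mult:
  fixes k :: "real \<Rightarrow> complex" and u :: "real \<Rightarrow> real"
  assumes k: "continuous_on {0..2 * pi} k" and u: "integrable angles u"
  shows "integrable angles (\<lambda>\<theta>. k \<theta> * of_real (u \<theta>))"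
proof -
  have "bounded (k ` {0..2 * pi})"
    by (intro compact_imp_bounded compact_continuous_image k) auto
  then obtain B where B: "\<And>\<theta>. \<theta> \<in> {0..2 * pi} \<Longrightarrow> norm (k \<theta>) \<le> B"
    unfolding bounded_iff by blast
  have [measurable]: "k \<in> borel_measurable angles"
    by (intro continuous_imp_measurable_on_sets_lebesgue k) auto
  have [measurable]: "u \<in> borel_measurable angles" using u by auto
  show ?thesis
  proof (rule Bochner_Integration.integrable_bound)
    show "integrable angles (\<lambda>\<theta>. B * u \<theta>)" using u by auto
    show "AE \<theta> in angles. norm (k \<theta> * of_real (u \<theta>)) \<le> norm (B * u \<theta>)"
    proof (rule AE_I2)
      fix \<theta> assume "\<theta> \<in> space angles"
      then have "norm (k \<theta>) \<le> \<bar>B\<bar>" using B[of \<theta>] by auto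
      then show "norm (k \<theta> * of_real (u \<theta>)) \<le> norm (B * u \<theta>)"
        by (simp add: norm_mult abs_mult mult_right_mono)
    qed
  qed auto
qed

lemma measure_angles: "Sigma_Algebra.measure angles {0..2 * pi} = 2 * pi"
  by (simp add: measure_restrict_space)

lemma integral_angles_const: "(\<integral>\<theta>. (c :: 'b :: euclidean_space) \<partial>angles) = (2 * pi) *\<^sub>R c"
  by (simp add: measure_angles)

text \<open>
  Since \<open>d\<zeta> = \<i> \<zeta> d\<theta>\<close> on the unit circle, the Cauchy kernel \<open>d\<zeta> / (\<zeta> - w)\<close> of the path integral
  becomes \<open>\<i> \<zeta> / (\<zeta> - w) d\<theta>\<close>.
\<close>

lemma cauchy_on_angles:
  fixes G :: "complex \<Rightarrow> complex"
  assumes "continuous_on (cball 0 1) G" "G holomorphic_on ball 0 1" "w \<in> ball 0 1"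
  shows "(\<integral>\<theta>. cis \<theta> / (cis \<theta> - w) * G (cis \<theta>) \<partial>angles) = 2 * pi * G w"
proof -
  have ne: "cis \<theta> - w \<noteq> 0" for \<theta> using cis_neq_interior[OF assms(3), of \<theta>] by simp
  have "((\<lambda>u. G u / (u - w)) has_contour_integral 2 * of_real pi * \<i> * G w) (part_circlepath 0 1 0 (2 * pi))"
    using Cauchy_integral_circlepath[OF assms(1,2), of w] assms(3) by (simp add: circlepath_def)
  then have "((\<lambda>t. G (cis t) / (cis t - w) * \<i> * cis t) has_integral 2 * of_real pi * \<i> * G w) {0..2 * pi}"
    by (subst (asm) has_contour_integral_part_circlepath_iff) auto
  from has_integral_mult_right[OF this, of "-\<i>"]
  have "((\<lambda>t. cis t / (cis t - w) * G (cis t)) has_integral 2 * pi * G w) {0..2 * pi}"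
    by (simp add: mult_ac)
  moreover have "integrable angles (\<lambda>t. cis t / (cis t - w) * G (cis t))"
    using ne by (intro integrable_angles_continuous continuous_intros
        continuous_on_compose2[OF assms(1)]) auto
  ultimately show ?thesis
    by (simp add: lebesgue_integral_eq_integral integral_unique)
qed

lemma mean_value_on_angles:
  fixes G :: "complex \<Rightarrow> complex"
  assumes "continuous_on (cball 0 1) G" "G holomorphic_on ball 0 1"
  shows "(\<integral>\<theta>. G (cis \<theta>) \<partial>angles) = 2 * pi * G 0"
  using cauchy_on_angles[OF assms, of 0] by simp

lemma coefficient_on_angles:
  fixes G :: "complex \<Rightarrow> complex"
  assumes "continuous_on (cball 0 1) G" "G holomorphic_on ball 0 1"
  shows "(\<integral>\<theta>. cnj (cis \<theta>) ^ n * G (cis \<theta>) \<partial>angles) = 2 * pi * ((deriv ^^ n) G 0 / fact n)"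
proof -
  have "((\<lambda>u. G u / (u - 0) ^ Suc n) has_contour_integral ((2 * pi * \<i>) / fact n * (deriv ^^ n) G 0))
      (part_circlepath 0 1 0 (2 * pi))"
    using Cauchy_has_contour_integral_higher_derivative_circlepath[OF assms, of 0 n]
    by (simp add: circlepath_def)
  then have "((\<lambda>t. G (cis t) / cis t ^ Suc n * \<i> * cis t) has_integral
      ((2 * pi * \<i>) / fact n * (deriv ^^ n) G 0)) {0..2 * pi}"
    by (subst (asm) has_contour_integral_part_circlepath_iff) auto
  from has_integral_mult_right[OF this, of "-\<i>"]
  have "((\<lambda>t. cnj (cis t) ^ n * G (cis t)) has_integral 2 * pi * ((deriv ^^ n) G 0 / fact n)) {0..2 * pi}"
    by (simp add: field_simps cis_cnj flip: cis_inverse)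
  moreover have "integrable angles (\<lambda>t. cnj (cis t) ^ n * G (cis t))"
    by (intro integrable_angles_continuous continuous_intros
        continuous_on_compose2[OF assms(1)]) auto
  ultimately show ?thesis
    by (simp add: lebesgue_integral_eq_integral integral_unique)
qed

text \<open>
  Write \<open>2 Re G\<close> as \<open>G + cnj G\<close>. The Schwarz kernel is twice the Cauchy kernel minus 1, so \<open>G\<close>
  contributes \<open>2 G w - G 0\<close>. The conjugate of the kernel extends from the circle to a function
  holomorphic in the disk with value 1 at the centre, so by the mean value property \<open>cnj G\<close>
  contributes only \<open>cnj (G 0)\<close>. The sum is \<open>2 (G w - \<i> Im (G 0))\<close>.
\<close>

lemma schwarz_formula:
  fixes G :: "complex \<Rightarrow> complex"
  assumes G: "continuous_on (cball 0 1) G" "G holomorphic_on ball 0 1" and w: "w \<in> ball 0 1"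
  shows "G w = \<i> * Im (G 0) + schwarz (\<lambda>\<theta>. Re (G (cis \<theta>))) w"
proof -
  have ne: "cis \<theta> - w \<noteq> 0" for \<theta> using cis_neq_interior[OF w, of \<theta>] by simp
  have ne': "1 - cnj w * z \<noteq> 0" if "norm z \<le> 1" for z
  proof -
    have "norm (cnj w * z) < 1"
      using w mult_left_mono[OF that norm_ge_zero[of w]] by (auto simp: norm_mult)
    then show ?thesis by auto
  qed
  have cont: "continuous_on A (\<lambda>\<theta>. G (cis \<theta>))" for A
    by (intro continuous_on_compose2[OF G(1)] continuous_intros) auto
  define k where "k \<theta> = (cis \<theta> + w) / (cis \<theta> - w)" for \<theta>
  have [continuous_intros]: "continuous_on A k" for A
    unfolding k_def using ne by (intro continuous_intros) auto
  have k1: "(\<integral>\<theta>. k \<theta> * G (cis \<theta>) \<partial>angles) = 2 * (2 * pi * G w) - 2 * pi * G 0"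
  proof -
    have "k \<theta> = 2 * (cis \<theta> / (cis \<theta> - w)) - 1" for \<theta>
      using ne[of \<theta>] by (simp add: k_def field_simps)
    then have "(\<integral>\<theta>. k \<theta> * G (cis \<theta>) \<partial>angles)
        = (\<integral>\<theta>. 2 * (cis \<theta> / (cis \<theta> - w) * G (cis \<theta>)) - G (cis \<theta>) \<partial>angles)"
      by (simp only: left_diff_distrib mult_1 mult.assoc)
    also have "\<dots> = 2 * (\<integral>\<theta>. cis \<theta> / (cis \<theta> - w) * G (cis \<theta>) \<partial>angles) - (\<integral>\<theta>. G (cis \<theta>) \<partial>angles)"
      unfolding integral_mult_right_zero[symmetric] using ne
      by (intro Bochner_Integration.integral_diff integrable_angles_continuous continuous_intros cont) auto
    finally show ?thesis
      by (simp only: cauchy_on_angles[OF G w] mean_value_on_angles[OF G])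
  qed
  have k2: "(\<integral>\<theta>. k \<theta> * cnj (G (cis \<theta>)) \<partial>angles) = 2 * pi * cnj (G 0)"
  proof -
    have "cnj (k \<theta>) = (1 + cnj w * cis \<theta>) / (1 - cnj w * cis \<theta>)" for \<theta>
      using ne[of \<theta>] ne'[of "cis \<theta>"] 
      by (simp add: k_def field_simps cis_cnj flip: cis_inverse)
    then have "(\<integral>\<theta>. cnj (k \<theta>) * G (cis \<theta>) \<partial>angles)
        = (\<integral>\<theta>. (1 + cnj w * cis \<theta>) / (1 - cnj w * cis \<theta>) * G (cis \<theta>) \<partial>angles)"
      by simp
    also have "\<dots> = 2 * pi * ((1 + cnj w * 0) / (1 - cnj w * 0) * G 0)"
      using ne' by (intro mean_value_on_angles[where G = "\<lambda>z. (1 + cnj w * z) / (1 - cnj w * z) * G z"])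
        (auto intro!: continuous_intros holomorphic_intros G)
    finally have "(\<integral>\<theta>. cnj (k \<theta>) * G (cis \<theta>) \<partial>angles) = 2 * pi * G 0" by simp
    from arg_cong[OF this, of cnj] show ?thesis
      by (simp flip: Bochner_Integration.integral_cnj)
  qed
  have Re_eq: "k \<theta> * of_real (Re x) = (k \<theta> * x + k \<theta> * cnj x) / 2" for \<theta> x
    by (simp add: complex_add_cnj flip: distrib_left)
  have "2 * pi * schwarz (\<lambda>\<theta>. Re (G (cis \<theta>))) w = (\<integral>\<theta>. k \<theta> * of_real (Re (G (cis \<theta>))) \<partial>angles)"
    by (simp add: schwarz_def k_def)
  also have "\<dots> = (\<integral>\<theta>. (k \<theta> * G (cis \<theta>) + k \<theta> * cnj (G (cis \<theta>))) / 2 \<partial>angles)"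
    by (simp only: Re_eq)
  also have "\<dots> = (2 * (2 * pi * G w) - 2 * pi * G 0 + 2 * pi * cnj (G 0)) / 2"
    unfolding k1[symmetric] k2[symmetric] Bochner_Integration.integral_divide_zero
    by (subst Bochner_Integration.integral_add)
      (auto intro!: integrable_angles_continuous continuous_intros cont)
  also have "\<dots> = 2 * pi * (G w - \<i> * Im (G 0))"
  proof -
    have "cnj (G 0) = G 0 - 2 * \<i> * Im (G 0)"
      by (simp add: complex_eq_iff)
    then show ?thesis by (simp only:) (simp add: field_simps)
  qed
  finally show ?thesis by simp
qed

section \<open>The Schwarz integral of an integrable function\<close>

text \<open>
  Expanding the Cauchy kernel in a geometric series exhibits the integral as a power series whose
  coefficients are the Fourier coefficients of \<open>u\<close>.
\<close>

lemma schwarz_holomorphic: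
  assumes u: "integrable angles u"
  shows "schwarz u holomorphic_on ball 0 1"
proof -
  define a where "a n = (\<integral>\<theta>. cnj (cis \<theta>) ^ n * of_real (u \<theta>) \<partial>angles)" for n
  define K where "K z = (\<integral>\<theta>. cis \<theta> / (cis \<theta> - z) * of_real (u \<theta>) \<partial>angles)" for z
  have int: "integrable angles (\<lambda>\<theta>. cnj (cis \<theta>) ^ n * of_real (u \<theta>))" for n
    by (intro integrable_angles_mult u continuous_intros)
  have "(\<lambda>n. a n * (z - 0) ^ n) sums K z" if z: "z \<in> ball 0 1" for z
  proof -
    have lt: "norm z < 1" using z by simp
    have geom: "(\<lambda>n. cnj (cis \<theta>) ^ n * of_real (u \<theta>) * z ^ n) sums
        (cis \<theta> / (cis \<theta> - z) * of_real (u \<theta>))" for \<theta>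
    proof -
      have "(\<lambda>n. (cnj (cis \<theta>) * z) ^ n) sums (1 / (1 - cnj (cis \<theta>) * z))"
        using lt by (intro geometric_sums) (simp add: norm_mult)
      also have "1 / (1 - cnj (cis \<theta>) * z) = cis \<theta> / (cis \<theta> - z)"
        using cis_neq_interior[OF z, of \<theta>] by (simp add: cis_cnj field_simps flip: cis_inverse)
      finally have "(\<lambda>n. (cnj (cis \<theta>) * z) ^ n) sums (cis \<theta> / (cis \<theta> - z))" .
      from sums_mult2[OF this, of "of_real (u \<theta>)"] show ?thesis
        by (simp add: power_mult_distrib mult_ac)
    qed
    have "(\<lambda>n. \<integral>\<theta>. cnj (cis \<theta>) ^ n * of_real (u \<theta>) * z ^ n \<partial>angles) sums
        (\<integral>\<theta>. (\<Sum>n. cnj (cis \<theta>) ^ n * of_real (u \<theta>) * z ^ n) \<partial>angles)"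
    proof (rule sums_integral)
      show "integrable angles (\<lambda>\<theta>. cnj (cis \<theta>) ^ n * of_real (u \<theta>) * z ^ n)" for n
        using int by simp
      show "AE \<theta> in angles. summable (\<lambda>n. norm (cnj (cis \<theta>) ^ n * of_real (u \<theta>) * z ^ n))"
        using lt by (simp add: norm_mult norm_power summable_geometric summable_mult)
      show "summable (\<lambda>n. \<integral>\<theta>. norm (cnj (cis \<theta>) ^ n * of_real (u \<theta>) * z ^ n) \<partial>angles)"
        using lt by (simp add: norm_mult norm_power summable_geometric summable_mult)
    qed
    then show ?thesis
      using geom by (simp add: a_def K_def sums_iff)
  qed
  then have K: "K holomorphic_on ball 0 1"
    by (rule power_series_holomorphic)
  have "schwarz u z = (2 * K z - (\<integral>\<theta>. of_real (u \<theta>) \<partial>angles)) / (2 * pi)" if z: "z \<in> ball 0 1" for z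
  proof -
    have ne: "cis \<theta> - z \<noteq> 0" for \<theta> using cis_neq_interior[OF z, of \<theta>] by simp
    have "(cis \<theta> + z) / (cis \<theta> - z) = 2 * (cis \<theta> / (cis \<theta> - z)) - 1" for \<theta>
      using ne[of \<theta>] by (simp add: field_simps)
    then have "(\<integral>\<theta>. (cis \<theta> + z) / (cis \<theta> - z) * of_real (u \<theta>) \<partial>angles)
        = (\<integral>\<theta>. 2 * (cis \<theta> / (cis \<theta> - z) * of_real (u \<theta>)) - of_real (u \<theta>) \<partial>angles)"
      by (simp only: left_diff_distrib mult_1 mult.assoc)
    also have "\<dots> = 2 * K z - (\<integral>\<theta>. of_real (u \<theta>) \<partial>angles)"
      unfolding K_def integral_mult_right_zero[symmetric] using ne u
      by (intro Bochner_Integration.integral_diff integrable_mult_right integrable_angles_mult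
            continuous_intros integrable_of_real) auto
    finally show ?thesis by (simp add: schwarz_def)
  qed
  note schwarz_eq = this
  show ?thesis
  proof (rule holomorphic_transform)
    show "(\<lambda>z. (2 * K z - (\<integral>\<theta>. of_real (u \<theta>) \<partial>angles)) / (2 * pi)) holomorphic_on ball 0 1"
      by (intro holomorphic_intros K) auto
  qed (rule schwarz_eq[symmetric])
qed

lemma schwarz_diff:
  assumes "integrable angles u" "integrable angles v" and z: "z \<in> ball 0 1"
  shows "schwarz (\<lambda>\<theta>. u \<theta> - v \<theta>) z = schwarz u z - schwarz v z"
  unfolding schwarz_def of_real_diff right_diff_distrib
  by (subst Bochner_Integration.integral_diff)
    (intro integrable_angles_mult continuous_cis_kernel assms diff_divide_distrib)+

lemma Re_schwarz:
  assumes "integrable angles u" and z: "z \<in> ball 0 1"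
  shows "integrable angles (\<lambda>\<theta>. Re ((cis \<theta> + z) / (cis \<theta> - z)) * u \<theta>)"
    and "Re (schwarz u z) = (\<integral>\<theta>. Re ((cis \<theta> + z) / (cis \<theta> - z)) * u \<theta> \<partial>angles) / (2 * pi)"
proof -
  have i: "integrable angles (\<lambda>\<theta>. (cis \<theta> + z) / (cis \<theta> - z) * of_real (u \<theta>))"
    by (intro integrable_angles_mult continuous_cis_kernel assms)
  have Re_eq: "Re ((cis \<theta> + z) / (cis \<theta> - z) * of_real (u \<theta>)) = Re ((cis \<theta> + z) / (cis \<theta> - z)) * u \<theta>" for \<theta>
    by (simp del: times_divide_eq_left)
  from integrable_Re[OF i]
  show "integrable angles (\<lambda>\<theta>. Re ((cis \<theta> + z) / (cis \<theta> - z)) * u \<theta>)" unfolding Re_eq .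
  show "Re (schwarz u z) = (\<integral>\<theta>. Re ((cis \<theta> + z) / (cis \<theta> - z)) * u \<theta> \<partial>angles) / (2 * pi)"
    unfolding schwarz_def integral_Re[OF i, unfolded Re_eq]
    by (simp only: Re_divide_of_real flip: of_real_mult)
qed

lemma Re_schwarz_mono:
  assumes "integrable angles u" "integrable angles v" "z \<in> ball 0 1"
    and "\<And>\<theta>. u \<theta> \<le> v \<theta>"
  shows "Re (schwarz u z) \<le> Re (schwarz v z)"
  using assms kernel_Re_nonneg[OF assms(3)]
  by (simp only: Re_schwarz(2)) (intro divide_right_mono integral_mono Re_schwarz(1) mult_left_mono; simp)

text \<open>
  This is the normalisation of the Poisson kernel, as the Schwarz formula for a constant function.
\<close>

lemma schwarz_const:
  assumes "z \<in> ball 0 1"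
  shows "schwarz (\<lambda>\<theta>. c) z = of_real c"
  using schwarz_formula[of "\<lambda>z. of_real c" z] assms by (simp add: continuous_on_const)

lemma schwarz_uminus: "schwarz (\<lambda>\<theta>. - u \<theta>) z = - schwarz u z"
  by (simp add: schwarz_def)

text \<open>
  Constant \<open>v\<close> gives the maximum principle, \<open>v = \<bar>u\<bar>\<close> the \<open>L\<^sup>1\<close> estimate.
\<close>

lemma abs_Re_schwarz_le:
  assumes "integrable angles u" "integrable angles v" "z \<in> ball 0 1"
    and "\<And>\<theta>. \<bar>u \<theta>\<bar> \<le> v \<theta>"
  shows "\<bar>Re (schwarz u z)\<bar> \<le> Re (schwarz v z)"
proof -
  have le: "u \<theta> \<le> v \<theta>" "- u \<theta> \<le> v \<theta>" for \<theta> using assms(4)[of \<theta>] by auto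
  have "Re (schwarz (\<lambda>\<theta>. - u \<theta>) z) \<le> Re (schwarz v z)"
    using assms le by (intro Re_schwarz_mono) auto
  moreover have "Re (schwarz u z) \<le> Re (schwarz v z)"
    using assms le by (intro Re_schwarz_mono) auto
  ultimately show ?thesis by (simp add: schwarz_uminus)
qed

lemma norm_schwarz_le:
  assumes "integrable angles u" "z \<in> ball 0 1"
  shows "norm (schwarz u z) \<le> (1 + norm z) / (1 - norm z) * ((\<integral>\<theta>. \<bar>u \<theta>\<bar> \<partial>angles) / (2 * pi))"
proof -
  have "norm (\<integral>\<theta>. (cis \<theta> + z) / (cis \<theta> - z) * of_real (u \<theta>) \<partial>angles)
      \<le> (\<integral>\<theta>. (1 + norm z) / (1 - norm z) * \<bar>u \<theta>\<bar> \<partial>angles)"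
  proof (rule Bochner_Integration.integral_norm_bound_integral)
    show "norm ((cis \<theta> + z) / (cis \<theta> - z) * of_real (u \<theta>)) \<le> (1 + norm z) / (1 - norm z) * \<bar>u \<theta>\<bar>" for \<theta>
      using kernel_bound[OF assms(2)] by (simp only: norm_mult norm_of_real mult_right_mono abs_ge_zero)
  qed (use assms in \<open>auto intro!: integrable_angles_mult continuous_cis_kernel simp del: times_divide_eq_left\<close>)
  from divide_right_mono[OF this, of "2 * pi"] show ?thesis
    by (simp add: schwarz_def norm_divide)
qed

section \<open>Dilates of a holomorphic function\<close>

lemma dilate_disc_algebra:
  assumes "h holomorphic_on ball 0 1" "r \<in> {0..<1}"
  shows "continuous_on (cball 0 1) (\<lambda>z. h (of_real r * z))"
    and "(\<lambda>z. h (of_real r * z)) holomorphic_on ball 0 1"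
proof -
  have *: "of_real r * z \<in> ball 0 1" if "norm z \<le> 1" for z :: complex
    using assms(2) that mult_left_le[of "norm z" r] by (auto simp: norm_mult)
  show "continuous_on (cball 0 1) (\<lambda>z. h (of_real r * z))"
    using * by (intro continuous_on_compose2[OF holomorphic_on_imp_continuous_on[OF assms(1)]] continuous_intros) auto
  show "(\<lambda>z. h (of_real r * z)) holomorphic_on ball 0 1"
    using * by (intro holomorphic_on_compose_gen[OF _ assms(1), unfolded o_def] holomorphic_intros) auto
qed

lemma dilate_continuous_on_angles:
  assumes "h holomorphic_on ball 0 1" "r \<in> {0..<1}"
  shows "continuous_on A (\<lambda>\<theta>. h (of_real r * cis \<theta>))"
  by (rule continuous_on_compose2[OF dilate_disc_algebra(1)[OF assms]]) (auto intro!: continuous_intros)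

text \<open>
  For \<open>h z = (\<Sum>n. a n * z ^ n)\<close>, Parseval gives \<open>2 \<pi> (\<Sum>n. \<bar>a n\<bar>\<^sup>2 (r s) ^ n)\<close> for the Hermitian product of the
  dilates with radii \<open>r\<close> and \<open>s\<close>. Passing to real parts adds the integral of the plain product of
  the dilates, which does not depend on the radii by the mean value property.
\<close>

lemma dilate_correlation:
  assumes h: "h holomorphic_on ball 0 1"
  shows "\<exists>C. mono_on {0..<1} C \<and> (\<forall>r\<in>{0..<1}. \<forall>s\<in>{0..<1}.
    (\<integral>\<theta>. Re (h (of_real r * cis \<theta>)) * Re (h (of_real s * cis \<theta>)) \<partial>angles) = C (r * s))"
proof -
  define a where "a n = (deriv ^^ n) h 0 / fact n" for n
  define C where "C t = pi * Re (h 0 ^ 2) + pi * (\<Sum>n. norm (a n) ^ 2 * t ^ n)" for t :: real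
  note cont [continuous_intros] = dilate_continuous_on_angles[OF h]
  have series: "(\<lambda>n. a n * z ^ n) sums h z" if "z \<in> ball 0 1" for z
    using holomorphic_power_series[OF h that] by (simp add: a_def)
  have parseval: "(\<lambda>n. of_real (norm (a n) ^ 2 * (r * s) ^ n)) sums
      ((\<integral>\<theta>. h (of_real s * cis \<theta>) * cnj (h (of_real r * cis \<theta>)) \<partial>angles) / (2 * pi))"
    if r: "r \<in> {0..<1}" and s: "s \<in> {0..<1}" for r s
  proof -
    define t where "t n \<theta> = cnj (a n * of_real r ^ n) * (cnj (cis \<theta>) ^ n * h (of_real s * cis \<theta>))" for n \<theta>
    have summ: "summable (\<lambda>n. norm (a n) * r ^ n)"
    proof -
      \<comment> \<open>Convergence at the larger radius \<open>q\<close> forces absolute convergence at \<open>r\<close>.\<close>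
      define q where "q = (1 + r) / 2"
      have "summable (\<lambda>n. a n * of_real q ^ n)"
        using series[of "of_real q"] r by (auto simp: sums_iff q_def simp del: of_real_divide of_real_add)
      then have "summable (\<lambda>n. norm (a n * of_real r ^ n))"
      proof (rule powser_insidea)
        show "norm (of_real r :: complex) < norm (of_real q :: complex)"
          unfolding norm_of_real using r by (auto simp: q_def)
      qed
      then show ?thesis using r by (simp add: norm_mult norm_power)
    qed
    have t_sums: "(\<lambda>n. t n \<theta>) sums (h (of_real s * cis \<theta>) * cnj (h (of_real r * cis \<theta>)))" for \<theta>
    proof -
      have "(\<lambda>n. cnj (a n * (of_real r * cis \<theta>) ^ n)) sums cnj (h (of_real r * cis \<theta>))"
        using series[of "of_real r * cis \<theta>"] r by (simp add: sums_cnj norm_mult del: complex_cnj_mult complex_cnj_power)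
      from sums_mult[OF this, of "h (of_real s * cis \<theta>)"] show ?thesis
        by (simp add: t_def power_mult_distrib mult_ac)
    qed
    have t_int: "integrable angles (t n)" for n
      unfolding t_def using s by (intro integrable_angles_continuous continuous_intros) auto
    have "(\<lambda>n. \<integral>\<theta>. t n \<theta> \<partial>angles) sums (\<integral>\<theta>. (\<Sum>n. t n \<theta>) \<partial>angles)"
    proof (rule sums_integral)
      have norm_t: "norm (t n \<theta>) = norm (a n) * r ^ n * norm (h (of_real s * cis \<theta>))" for n \<theta>
        using r by (simp add: t_def norm_mult norm_power)
      show "AE \<theta> in angles. summable (\<lambda>n. norm (t n \<theta>))"
        unfolding norm_t by (simp add: summ summable_mult2)
      show "summable (\<lambda>n. \<integral>\<theta>. norm (t n \<theta>) \<partial>angles)"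
        unfolding norm_t by (simp add: summ summable_mult2)
    qed (rule t_int)
    moreover have "(\<integral>\<theta>. t n \<theta> \<partial>angles) = 2 * of_real pi * complex_of_real (norm (a n) ^ 2 * (r * s) ^ n)" for n
    proof -
      have "(deriv ^^ n) (\<lambda>z. h (of_real s * z)) 0 = of_real s ^ n * (deriv ^^ n) h (of_real s * 0)"
        using s h by (intro higher_deriv_compose_linear[where S = "ball 0 1" and T = "ball 0 1"])
          (auto simp: norm_mult intro: mult_left_le le_less_trans[OF mult_left_le_one_le])
      then have "(\<integral>\<theta>. t n \<theta> \<partial>angles) = cnj (a n * of_real r ^ n) * (2 * pi * (of_real s ^ n * a n))"
        unfolding t_def a_def
        using coefficient_on_angles[OF dilate_disc_algebra[OF h s], of n] by simp
      moreover have "complex_of_real (norm (a n) ^ 2 * (r * s) ^ n) = a n * cnj (a n) * (of_real r * of_real s) ^ n"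
        unfolding of_real_mult of_real_power complex_norm_square[symmetric] ..
      ultimately show ?thesis
        by (simp only: complex_cnj_mult complex_cnj_power complex_cnj_complex_of_real
            of_real_mult of_real_numeral power_mult_distrib mult_ac)
    qed
    ultimately have "(\<lambda>n. 2 * of_real pi * complex_of_real (norm (a n) ^ 2 * (r * s) ^ n)) sums
      (\<integral>\<theta>. h (of_real s * cis \<theta>) * cnj (h (of_real r * cis \<theta>)) \<partial>angles)"
      using t_sums by (simp add: sums_iff)
    from sums_divide[OF this, of "2 * pi"] show ?thesis by simp
  qed
  have corr: "(\<integral>\<theta>. Re (h (of_real r * cis \<theta>)) * Re (h (of_real s * cis \<theta>)) \<partial>angles) = C (r * s)"
    if r: "r \<in> {0..<1}" and s: "s \<in> {0..<1}" for r s
  proof -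
    have i1: "integrable angles (\<lambda>\<theta>. h (of_real s * cis \<theta>) * h (of_real r * cis \<theta>))"
      and i2: "integrable angles (\<lambda>\<theta>. h (of_real s * cis \<theta>) * cnj (h (of_real r * cis \<theta>)))"
      using r s by (auto intro!: integrable_angles_continuous continuous_intros)
    have m1: "(\<integral>\<theta>. h (of_real s * cis \<theta>) * h (of_real r * cis \<theta>) \<partial>angles) = 2 * pi * h 0 ^ 2"
      using mean_value_on_angles[OF
          continuous_on_mult[OF dilate_disc_algebra(1)[OF h s] dilate_disc_algebra(1)[OF h r]]
          holomorphic_on_mult[OF dilate_disc_algebra(2)[OF h s] dilate_disc_algebra(2)[OF h r]]]
      by (simp add: power2_eq_square)
    have m2: "Re (\<integral>\<theta>. h (of_real s * cis \<theta>) * cnj (h (of_real r * cis \<theta>)) \<partial>angles)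
        = 2 * pi * (\<Sum>n. norm (a n) ^ 2 * (r * s) ^ n)"
      using sums_Re[OF parseval[OF r s]] by (simp add: sums_iff Re_divide_of_real flip: of_real_mult)
    have "Re x * Re y = (Re (y * x) + Re (y * cnj x)) / 2" for x y
      by (simp add: algebra_simps)
    then have "(\<integral>\<theta>. Re (h (of_real r * cis \<theta>)) * Re (h (of_real s * cis \<theta>)) \<partial>angles)
       = (\<integral>\<theta>. (Re (h (of_real s * cis \<theta>) * h (of_real r * cis \<theta>))
            + Re (h (of_real s * cis \<theta>) * cnj (h (of_real r * cis \<theta>)))) / 2 \<partial>angles)"
      by presburger
    also have "\<dots> = (Re (\<integral>\<theta>. h (of_real s * cis \<theta>) * h (of_real r * cis \<theta>) \<partial>angles)
       + Re (\<integral>\<theta>. h (of_real s * cis \<theta>) * cnj (h (of_real r * cis \<theta>)) \<partial>angles)) / 2"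
      unfolding integral_Re[OF i1, symmetric] integral_Re[OF i2, symmetric]
        Bochner_Integration.integral_divide_zero
      by (subst Bochner_Integration.integral_add[OF integrable_Re[OF i1] integrable_Re[OF i2]]) simp
    also have "\<dots> = C (r * s)"
      unfolding m1 m2 by (simp add: C_def)
    finally show ?thesis .
  qed
  have "mono_on {0..<1} C"
  proof (rule mono_onI)
    fix x y :: real assume xy: "x \<in> {0..<1}" "y \<in> {0..<1}" "x \<le> y"
    have S: "summable (\<lambda>n. norm (a n) ^ 2 * t ^ n)" if "t \<in> {0..<1}" for t
    proof -
      have "sqrt t \<in> {0..<1}" using that by auto
      from sums_Re[OF parseval[OF this this]] that show ?thesis by (simp add: sums_iff)
    qed
    show "C x \<le> C y"
      unfolding C_def using xy
      by (auto intro!: add_left_mono mult_left_mono suminf_le S power_mono)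
  qed
  with corr show ?thesis by blast
qed

section \<open>Boundary functions as limits in the mean\<close>

text \<open>
  The argument for completeness of \<open>L\<^sup>1\<close>: the sum of the absolute increments is integrable, hence
  finite almost everywhere. Together with \<open>\<bar>f 0\<bar>\<close> it is the majorant \<open>w\<close>, which makes dominated
  convergence available for integrals of the \<open>f n\<close> against bounded kernels.
\<close>

lemma L1_fast_convergence:
  fixes f :: "nat \<Rightarrow> 'a \<Rightarrow> real"
  assumes f: "\<And>n. integrable M (f n)"
    and fast: "\<And>n. (\<integral>x. \<bar>f (Suc n) x - f n x\<bar> \<partial>M) \<le> (1/2) ^ n"
  obtains v w where "integrable M v" "integrable M w"
    "AE x in M. (\<lambda>n. f n x) \<longlonglongrightarrow> v x" "\<And>n. AE x in M. \<bar>f n x\<bar> \<le> w x"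
proof -
  define d where "d n x = f (Suc n) x - f n x" for n x
  have d: "integrable M (d n)" for n unfolding d_def using f by auto
  then have [measurable]: "d n \<in> borel_measurable M" for n by auto
  have sum_d: "summable (\<lambda>n. \<integral>x. \<bar>d n x\<bar> \<partial>M)"
    using fast by (intro summable_comparison_test'[OF summable_geometric[of "1/2::real"]]) (auto simp: d_def)
  have AE_sum: "AE x in M. summable (\<lambda>n. \<bar>d n x\<bar>)"
  proof -
    have "(\<integral>\<^sup>+x. (\<Sum>n. ennreal \<bar>d n x\<bar>) \<partial>M) = (\<Sum>n. \<integral>\<^sup>+x. ennreal \<bar>d n x\<bar> \<partial>M)"
      using d by (intro nn_integral_suminf) auto
    also have "\<dots> = (\<Sum>n. ennreal (\<integral>x. \<bar>d n x\<bar> \<partial>M))"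
      using d by (intro suminf_cong nn_integral_eq_integral) auto
    also have "\<dots> \<noteq> \<infinity>"
      using sum_d by (simp add: ennreal_suminf_neq_top)
    finally have "AE x in M. (\<Sum>n. ennreal \<bar>d n x\<bar>) \<noteq> \<infinity>"
      by (intro nn_integral_PInf_AE) simp_all
    then show ?thesis
      by eventually_elim (rule summable_suminf_not_top; simp)
  qed
  define w where "w x = \<bar>f 0 x\<bar> + (\<Sum>n. \<bar>d n x\<bar>)" for x
  define v where "v x = f 0 x + (\<Sum>n. d n x)" for x
  have tele: "f n x = f 0 x + (\<Sum>i<n. d i x)" for n x
    by (simp add: d_def sum_lessThan_telescope[of "\<lambda>n. f n x"])
  show thesis
  proof (rule that[of v w])
    show "integrable M w"
      unfolding w_def using f d AE_sum sum_d
      by (intro Bochner_Integration.integrable_add integrable_suminf integrable_abs) auto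
    show "integrable M v"
      unfolding v_def using f d AE_sum sum_d
      by (intro Bochner_Integration.integrable_add integrable_suminf) auto
    show "AE x in M. (\<lambda>n. f n x) \<longlonglongrightarrow> v x"
      using AE_sum
    proof eventually_elim
      case (elim x)
      then have "(\<lambda>n. d n x) sums (\<Sum>n. d n x)"
        by (rule summable_sums[OF summable_rabs_cancel])
      then have "(\<lambda>n. f 0 x + (\<Sum>i<n. d i x)) \<longlonglongrightarrow> v x"
        unfolding v_def sums_def by (intro tendsto_intros)
      then show ?case by (simp flip: tele)
    qed
    show "AE x in M. \<bar>f n x\<bar> \<le> w x" for n
      using AE_sum
    proof eventually_elim
      case (elim x)
      have "\<bar>f n x\<bar> \<le> \<bar>f 0 x\<bar> + (\<Sum>i<n. \<bar>d i x\<bar>)"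
        unfolding tele[of n] by (intro order_trans[OF abs_triangle_ineq] add_left_mono sum_abs)
      also have "(\<Sum>i<n. \<bar>d i x\<bar>) \<le> (\<Sum>i. \<bar>d i x\<bar>)"
        using elim by (intro sum_le_suminf) auto
      finally show ?case by (simp add: w_def)
    qed
  qed
qed

text \<open>
  This condition on \<open>Re h\<close> singles out Poisson integrals of integrable functions: for the Poisson kernel
  itself, which is the Poisson integral of a point mass, the dilates are bounded in \<open>L\<^sup>1\<close> but fail it.
\<close>

definition dilates_L1_Cauchy :: "(complex \<Rightarrow> complex) \<Rightarrow> bool" where
  "dilates_L1_Cauchy h \<longleftrightarrow> (\<forall>e>0. \<exists>R\<in>{0..<1}. \<forall>r\<in>{R..<1}. \<forall>s\<in>{R..<1}.
     (\<integral>\<theta>. \<bar>Re (h (of_real r * cis \<theta>)) - Re (h (of_real s * cis \<theta>))\<bar> \<partial>angles) < e)"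

text \<open>
  The correlation function \<open>C\<close> is increasing and bounded by \<open>2 \<pi> B\<^sup>2\<close>, so its values at
  \<open>r\<^sup>2\<close>, \<open>s\<^sup>2\<close> and \<open>r s\<close> are all close to its supremum once the radii are close to 1, and the squared
  \<open>L\<^sup>2\<close> distance of the dilates is small.
\<close>

lemma bounded_Re_dilates_L1_Cauchy:
  assumes h: "h holomorphic_on ball 0 1"
    and bd: "\<And>z. z \<in> ball 0 1 \<Longrightarrow> \<bar>Re (h z)\<bar> \<le> B"
  shows "dilates_L1_Cauchy h"
  unfolding dilates_L1_Cauchy_def
proof (intro allI impI)
  fix e :: real assume "e > 0"
  define X where "X r \<theta> = Re (h (of_real r * cis \<theta>))" for r \<theta>
  have contX [continuous_intros]: "continuous_on A (X r)" if "r \<in> {0..<1}" for A r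
    unfolding X_def using that by (intro continuous_intros dilate_continuous_on_angles[OF h])
  from dilate_correlation[OF h] obtain C where C: "mono_on {0..<1} C"
    "\<And>r s. r \<in> {0..<1} \<Longrightarrow> s \<in> {0..<1} \<Longrightarrow> (\<integral>\<theta>. X r \<theta> * X s \<theta> \<partial>angles) = C (r * s)"
    unfolding X_def by blast
  have C_le: "C t \<le> 2 * pi * B\<^sup>2" if t: "t \<in> {0..<1}" for t
  proof -
    have st: "sqrt t \<in> {0..<1}" using t by auto
    have "C t = (\<integral>\<theta>. X (sqrt t) \<theta> * X (sqrt t) \<theta> \<partial>angles)"
      using C(2)[OF st st] t by simp
    also have "\<dots> \<le> (\<integral>\<theta>. B\<^sup>2 \<partial>angles)"
    proof (rule integral_mono)
      fix \<theta>
      have "\<bar>X (sqrt t) \<theta>\<bar> \<le> B"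
        using st unfolding X_def by (intro bd) (auto simp: norm_mult)
      then show "X (sqrt t) \<theta> * X (sqrt t) \<theta> \<le> B\<^sup>2"
        by (metis abs_ge_zero power2_abs power2_eq_square power_mono)
    qed (use st in \<open>auto intro!: integrable_angles_continuous continuous_intros\<close>)
    also have "\<dots> = 2 * pi * B\<^sup>2" by (simp only: integral_angles_const) simp
    finally show ?thesis .
  qed
  define L where "L = (SUP t\<in>{0..<1}. C t)"
  have bdd: "bdd_above (C ` {0..<1})" by (rule bdd_aboveI2[OF C_le])
  have L: "C t \<le> L" if "t \<in> {0..<1}" for t
    unfolding L_def using that bdd by (rule cSUP_upper)
  \<comment> \<open>The step from the mean square to the mean uses \<open>\<bar>x\<bar> \<le> \<eta> + x\<^sup>2 / \<eta>\<close>. The total bound is then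
    \<open>2 \<pi> \<eta> + 2 \<delta> / \<eta>\<close>, where \<open>2 \<delta>\<close> bounds the mean square; the two terms are
    \<open>e / 2\<close> and \<open>e / 4\<close>.\<close>
  define \<eta> where "\<eta> = e / (4 * pi)"
  have \<eta>: "\<eta> > 0" using \<open>e > 0\<close> by (simp add: \<eta>_def)
  define \<delta> where "\<delta> = \<eta> * e / 8"
  have \<delta>: "\<delta> > 0" using \<open>e > 0\<close> \<eta> by (simp add: \<delta>_def)
  obtain t where t: "t \<in> {0..<1}" "L - \<delta> < C t"
    using less_cSUP_iff[OF _ bdd, of "L - \<delta>"] \<delta> by (auto simp: L_def)
  have near: "L - \<delta> < C x" if "t \<le> x" "x < 1" for x
    using mono_onD[OF C(1), of t x] that t by auto
  show "\<exists>R\<in>{0..<1}. \<forall>r\<in>{R..<1}. \<forall>s\<in>{R..<1}.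
     (\<integral>\<theta>. \<bar>Re (h (of_real r * cis \<theta>)) - Re (h (of_real s * cis \<theta>))\<bar> \<partial>angles) < e"
  proof (intro bexI ballI)
    show "sqrt t \<in> {0..<1}" using t by auto
    fix r s assume "r \<in> {sqrt t..<1}" "s \<in> {sqrt t..<1}"
    then have rs: "r \<in> {0..<1}" "s \<in> {0..<1}" "sqrt t \<le> r" "sqrt t \<le> s"
      using t by (auto intro: order_trans[OF real_sqrt_ge_zero])
    have prod: "t \<le> x * y \<and> x * y < 1" if "x \<in> {0..<1}" "y \<in> {0..<1}" "sqrt t \<le> x" "sqrt t \<le> y" for x y
      using that t mult_mono[of "sqrt t" x "sqrt t" y] mult_strict_mono'[of x 1 y 1] by auto
    have i: "integrable angles (\<lambda>\<theta>. X x \<theta> * X y \<theta>)" if "x \<in> {0..<1}" "y \<in> {0..<1}" for x y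
      using that by (intro integrable_angles_continuous continuous_intros) auto
    have "(\<integral>\<theta>. (X r \<theta> - X s \<theta>)\<^sup>2 \<partial>angles)
        = (\<integral>\<theta>. (X r \<theta> * X r \<theta> + X s \<theta> * X s \<theta>) - 2 * (X r \<theta> * X s \<theta>) \<partial>angles)"
      by (simp add: power2_eq_square algebra_simps)
    also have "\<dots> = (C (r * r) + C (s * s)) - 2 * C (r * s)"
      using rs by (simp add: i C(2)[symmetric])
    also have "\<dots> \<le> 2 * \<delta>"
      using L[of "r * r"] L[of "s * s"] near[of "r * s"] prod[of r r] prod[of s s] prod[of r s] rs
      by auto
    finally have sq: "(\<integral>\<theta>. (X r \<theta> - X s \<theta>)\<^sup>2 \<partial>angles) \<le> 2 * \<delta>" .
    have "(\<integral>\<theta>. \<bar>X r \<theta> - X s \<theta>\<bar> \<partial>angles) \<le> (\<integral>\<theta>. \<eta> + (X r \<theta> - X s \<theta>)\<^sup>2 / \<eta> \<partial>angles)"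
    proof (rule integral_mono)
      fix \<theta>
      define x where "x = \<bar>X r \<theta> - X s \<theta>\<bar>"
      have "x \<le> \<eta> + x\<^sup>2 / \<eta>"
      proof (cases "x \<le> \<eta>")
        case False
        then have "x * \<eta> \<le> x * x" using \<eta> by (intro mult_left_mono) auto
        then have "x \<le> x\<^sup>2 / \<eta>" using \<eta> by (simp add: field_simps power2_eq_square)
        then show ?thesis using \<eta> by simp
      qed (use \<eta> in \<open>auto intro: add_increasing2\<close>)
      then show "\<bar>X r \<theta> - X s \<theta>\<bar> \<le> \<eta> + (X r \<theta> - X s \<theta>)\<^sup>2 / \<eta>"
        by (simp add: x_def)
    qed (use rs \<eta> in \<open>auto intro!: integrable_angles_continuous continuous_intros\<close>)
    also have "\<dots> = 2 * pi * \<eta> + (\<integral>\<theta>. (X r \<theta> - X s \<theta>)\<^sup>2 \<partial>angles) / \<eta>"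
      using rs \<eta> by (subst Bochner_Integration.integral_add)
        (auto intro!: integrable_angles_continuous continuous_intros simp: measure_angles)
    also have "\<dots> \<le> 2 * pi * \<eta> + 2 * \<delta> / \<eta>"
      using sq \<eta> by (intro add_left_mono divide_right_mono) auto
    also have "\<dots> < e"
      using \<open>e > 0\<close> \<eta> by (simp add: \<delta>_def) (simp add: \<eta>_def)
    finally show "(\<integral>\<theta>. \<bar>Re (h (of_real r * cis \<theta>)) - Re (h (of_real s * cis \<theta>))\<bar> \<partial>angles) < e"
      by (simp add: X_def)
  qed
qed

text \<open>
  Along radii increasing fast enough towards 1 the real parts of the dilates converge almost everywhere
  and dominatedly. The Schwarz formula holds for every dilate, and both of its sides pass to the limit.
\<close>

lemma schwarz_representation:
  assumes h: "h holomorphic_on ball 0 1" and cauchy: "dilates_L1_Cauchy h"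
  obtains v where "integrable angles v"
    "\<And>z. z \<in> ball 0 1 \<Longrightarrow> h z = \<i> * Im (h 0) + schwarz v z"
proof -
  define X where "X r \<theta> = Re (h (of_real r * cis \<theta>))" for r \<theta>
  have "\<exists>R\<in>{0..<1}. \<forall>r\<in>{R..<1}. \<forall>s\<in>{R..<1}. (\<integral>\<theta>. \<bar>X r \<theta> - X s \<theta>\<bar> \<partial>angles) < (1/2) ^ n" for n :: nat
    using cauchy unfolding dilates_L1_Cauchy_def X_def by simp
  then obtain R where R: "\<And>n. R n \<in> {0..<1}"
    "\<And>n r s. r \<in> {R n..<1} \<Longrightarrow> s \<in> {R n..<1} \<Longrightarrow> (\<integral>\<theta>. \<bar>X r \<theta> - X s \<theta>\<bar> \<partial>angles) < (1/2) ^ n"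
    by metis
  \<comment> \<open>The maximum with \<open>n / (n + 1)\<close> forces the radii to tend to 1. The maximum over all indices up
    to \<open>n\<close> makes both \<open>\<rho> n\<close> and \<open>\<rho> (n + 1)\<close> exceed \<open>R n\<close>.\<close>
  define \<rho> where "\<rho> n = max (n / Suc n) (Max (R ` {..n}))" for n :: nat
  have \<rho>01: "\<rho> n \<in> {0..<1}" for n
    using R(1) by (auto simp: \<rho>_def le_max_iff_disj)
  have R_le: "R i \<le> \<rho> n" if "i \<le> n" for i n
    unfolding \<rho>_def using that by (intro max.coboundedI2 Max_ge) auto
  have \<rho>_lim: "\<rho> \<longlonglongrightarrow> 1"
  proof (rule tendsto_sandwich)
    show "(\<lambda>n. n / Suc n) \<longlonglongrightarrow> (1::real)" by (rule LIMSEQ_n_over_Suc_n)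
    show "\<forall>\<^sub>F n in sequentially. \<rho> n \<le> 1" using \<rho>01 by (auto intro!: always_eventually less_imp_le)
  qed (auto simp: \<rho>_def)
  have cont: "continuous_on A (X (\<rho> n))" for A n
    unfolding X_def by (intro continuous_intros dilate_continuous_on_angles[OF h \<rho>01])
  have int: "integrable angles (X (\<rho> n))" for n
    by (intro integrable_angles_continuous cont)
  have fast: "(\<integral>\<theta>. \<bar>X (\<rho> (Suc n)) \<theta> - X (\<rho> n) \<theta>\<bar> \<partial>angles) \<le> (1/2) ^ n" for n
    using R(2)[of "\<rho> (Suc n)" n "\<rho> n"] R_le[of n n] R_le[of n "Suc n"] \<rho>01 by force
  obtain v w where v: "integrable angles v" and w: "integrable angles w"
    and lim: "AE \<theta> in angles. (\<lambda>n. X (\<rho> n) \<theta>) \<longlonglongrightarrow> v \<theta>"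
    and le: "\<And>n. AE \<theta> in angles. \<bar>X (\<rho> n) \<theta>\<bar> \<le> w \<theta>"
    using L1_fast_convergence[of angles "\<lambda>n. X (\<rho> n)", OF int fast] by blast
  have "h z = \<i> * Im (h 0) + schwarz v z" if z: "z \<in> ball 0 1" for z
  proof (rule LIMSEQ_unique)
    have "(\<lambda>n. h (of_real (\<rho> n) * z)) \<longlonglongrightarrow> h (of_real 1 * z)"
    proof (rule isCont_tendsto_compose[where g = h])
      show "isCont h (of_real 1 * z)"
        using continuous_on_interior[OF holomorphic_on_imp_continuous_on[OF h]] z by simp
      show "(\<lambda>n. of_real (\<rho> n) * z) \<longlonglongrightarrow> of_real 1 * z"
        by (intro tendsto_intros \<rho>_lim)
    qed
    then show "(\<lambda>n. h (of_real (\<rho> n) * z)) \<longlonglongrightarrow> h z" by simp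
    let ?k = "\<lambda>\<theta>. (cis \<theta> + z) / (cis \<theta> - z)" and ?K = "(1 + norm z) / (1 - norm z)"
    have "(\<lambda>n. \<integral>\<theta>. ?k \<theta> * of_real (X (\<rho> n) \<theta>) \<partial>angles) \<longlonglongrightarrow> (\<integral>\<theta>. ?k \<theta> * of_real (v \<theta>) \<partial>angles)"
    proof (rule integral_dominated_convergence[where w = "\<lambda>\<theta>. ?K * w \<theta>"])
      show "integrable angles (\<lambda>\<theta>. ?K * w \<theta>)" using w by simp
      show "(\<lambda>\<theta>. ?k \<theta> * of_real (v \<theta>)) \<in> borel_measurable angles"
        by (intro borel_measurable_integrable integrable_angles_mult continuous_cis_kernel z v)
      show "(\<lambda>\<theta>. ?k \<theta> * of_real (X (\<rho> n) \<theta>)) \<in> borel_measurable angles" for n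
        by (intro borel_measurable_integrable integrable_angles_mult continuous_cis_kernel z
            integrable_angles_continuous cont)
      show "AE \<theta> in angles. (\<lambda>n. ?k \<theta> * of_real (X (\<rho> n) \<theta>)) \<longlonglongrightarrow> ?k \<theta> * of_real (v \<theta>)"
        using lim by eventually_elim (intro tendsto_intros)
      show "AE \<theta> in angles. norm (?k \<theta> * of_real (X (\<rho> n) \<theta>)) \<le> ?K * w \<theta>" for n
        using le[of n]
      proof eventually_elim
        case (elim \<theta>)
        have "norm (?k \<theta>) * \<bar>X (\<rho> n) \<theta>\<bar> \<le> ?K * w \<theta>"
          using z by (intro mult_mono kernel_bound elim) auto
        then show ?case by (simp only: norm_mult norm_of_real)
      qed
    qed
    then have "(\<lambda>n. schwarz (X (\<rho> n)) z) \<longlonglongrightarrow> schwarz v z"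
      unfolding schwarz_def by (intro tendsto_divide tendsto_const) auto
    moreover have "h (of_real (\<rho> n) * z) = \<i> * Im (h 0) + schwarz (X (\<rho> n)) z" for n
      using schwarz_formula[OF dilate_disc_algebra[OF h \<rho>01[of n]] z] by (simp add: X_def[abs_def])
    ultimately show "(\<lambda>n. h (of_real (\<rho> n) * z)) \<longlonglongrightarrow> \<i> * Im (h 0) + schwarz v z"
      by (simp add: tendsto_add_const_iff)
  qed
  with v that show thesis by blast
qed

section \<open>Composition with a self-map of the disk\<close>

lemma truncation_L1:
  fixes u :: "'a \<Rightarrow> real"
  assumes u: "integrable M u" and "e > 0"
  obtains u' B where "integrable M u'" "\<And>x. \<bar>u' x\<bar> \<le> B" "(\<integral>x. \<bar>u x - u' x\<bar> \<partial>M) < e"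
proof -
  define t where "t n x = max (- real n) (min (real n) (u x))" for n x
  have [measurable]: "u \<in> borel_measurable M" using u by auto
  have t: "integrable M (t n)" for n
    by (rule Bochner_Integration.integrable_bound[OF u]) (auto simp: t_def[abs_def])
  have "(\<lambda>n. \<integral>x. \<bar>u x - t n x\<bar> \<partial>M) \<longlonglongrightarrow> (\<integral>x. 0 \<partial>M)"
  proof (rule integral_dominated_convergence[where w = "\<lambda>x. \<bar>u x\<bar>"])
    have "(\<lambda>n. \<bar>u x - t n x\<bar>) \<longlonglongrightarrow> 0" for x
    proof (rule tendsto_eventually)
      obtain N where "\<bar>u x\<bar> \<le> real N" using real_arch_simple by blast
      then have "\<bar>u x - t n x\<bar> = 0" if "n \<ge> N" for n
        using that by (auto simp: t_def)
      then show "\<forall>\<^sub>F n in sequentially. \<bar>u x - t n x\<bar> = 0"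
        using eventually_sequentially by blast
    qed
    then show "AE x in M. (\<lambda>n. \<bar>u x - t n x\<bar>) \<longlonglongrightarrow> 0" by simp
    show "AE x in M. norm \<bar>u x - t n x\<bar> \<le> \<bar>u x\<bar>" for n
      by (auto simp: t_def)
  qed (use u t in auto)
  then have "\<forall>\<^sub>F n in sequentially. (\<integral>x. \<bar>u x - t n x\<bar> \<partial>M) < e"
    using \<open>e > 0\<close> by (intro order_tendstoD) auto
  then obtain n where "(\<integral>x. \<bar>u x - t n x\<bar> \<partial>M) < e"
    by (auto simp: eventually_sequentially)
  moreover have "\<bar>t n x\<bar> \<le> real n" for x by (auto simp: t_def)
  ultimately show thesis using that[of "t n"] t by blast
qed

text \<open>
  For bounded \<open>u'\<close> close to \<open>u\<close> in \<open>L\<^sup>1\<close>, the dilates of \<open>H u' \<circ> \<phi>\<close> form a Cauchy family because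
  \<open>H u'\<close> has bounded real part. On the circle of radius \<open>r\<close> the difference of the real parts of
  \<open>H u \<circ> \<phi>\<close> and \<open>H u' \<circ> \<phi>\<close> is dominated by the harmonic function \<open>Re (H \<bar>u - u'\<bar>) \<circ> \<phi>\<close>. Its
  mean is its value at 0, whatever \<open>r\<close> is; this is where a bound independent of \<open>r\<close> comes from,
  although \<open>\<phi>\<close> may come arbitrarily close to the unit circle.
\<close>

lemma schwarz_compose_dilates_L1_Cauchy:
  assumes u: "integrable angles u"
    and \<phi>: "\<phi> holomorphic_on ball 0 1" "\<phi> ` ball 0 1 \<subseteq> ball 0 1"
  shows "dilates_L1_Cauchy (schwarz u \<circ> \<phi>)"
  unfolding dilates_L1_Cauchy_def
proof (intro allI impI)
  fix e :: real assume "e > 0"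
  have \<phi>_in: "\<phi> z \<in> ball 0 1" if "z \<in> ball 0 1" for z using \<phi>(2) that by blast
  have hol: "schwarz v \<circ> \<phi> holomorphic_on ball 0 1" if "integrable angles v" for v
    by (rule holomorphic_on_compose_gen[OF \<phi>(1) schwarz_holomorphic[OF that] \<phi>(2)])
  define K where "K = (1 + norm (\<phi> 0)) / (1 - norm (\<phi> 0))"
  have K: "K > 0" using \<phi>_in[of 0] by (auto simp: K_def add_pos_nonneg)
  obtain u' B where u': "integrable angles u'" "\<And>x. \<bar>u' x\<bar> \<le> B"
    and close: "(\<integral>x. \<bar>u x - u' x\<bar> \<partial>angles) < e / (3 * K)"
    using truncation_L1[OF u, of "e / (3 * K)"] K \<open>e > 0\<close> by auto
  define g where "g = (\<lambda>\<theta>. \<bar>u \<theta> - u' \<theta>\<bar>)"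
  have g: "integrable angles g" unfolding g_def using u u' by auto
  define X where "X v r \<theta> = Re ((schwarz v \<circ> \<phi>) (of_real r * cis \<theta>))" for v r \<theta>
  have X_int: "integrable angles (X v r)" if "integrable angles v" "r \<in> {0..<1}" for v r
    unfolding X_def by (intro integrable_angles_continuous continuous_intros
        dilate_continuous_on_angles[OF hol[OF that(1)] that(2)])
  have compare: "(\<integral>\<theta>. \<bar>X u r \<theta> - X u' r \<theta>\<bar> \<partial>angles) < e / 3" if r: "r \<in> {0..<1}" for r
  proof -
    have "(\<integral>\<theta>. \<bar>X u r \<theta> - X u' r \<theta>\<bar> \<partial>angles) \<le> (\<integral>\<theta>. X g r \<theta> \<partial>angles)"
    proof (rule integral_mono)
      fix \<theta>
      have z: "\<phi> (of_real r * cis \<theta>) \<in> ball 0 1"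
        using r by (intro \<phi>_in) (auto simp: norm_mult)
      have "X u r \<theta> - X u' r \<theta> = Re (schwarz (\<lambda>\<theta>. u \<theta> - u' \<theta>) (\<phi> (of_real r * cis \<theta>)))"
        unfolding schwarz_diff[OF u u'(1) z] by (simp add: X_def)
      then show "\<bar>X u r \<theta> - X u' r \<theta>\<bar> \<le> X g r \<theta>"
        using abs_Re_schwarz_le[OF _ g z, of "\<lambda>\<theta>. u \<theta> - u' \<theta>"] u u' by (simp add: X_def g_def)
    qed (use X_int u u' g r in auto)
    also have "\<dots> = Re (\<integral>\<theta>. (schwarz g \<circ> \<phi>) (of_real r * cis \<theta>) \<partial>angles)"
      unfolding X_def by (intro integral_Re integrable_angles_continuous dilate_continuous_on_angles hol g r)
    also have "\<dots> = 2 * pi * Re (schwarz g (\<phi> 0))"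
      using mean_value_on_angles[OF dilate_disc_algebra[OF hol[OF g] r]] by (simp flip: of_real_mult)
    also have "\<dots> \<le> 2 * pi * (K * ((\<integral>\<theta>. g \<theta> \<partial>angles) / (2 * pi)))"
      using norm_schwarz_le[OF g \<phi>_in[of 0]] complex_Re_le_cmod[of "schwarz g (\<phi> 0)"]
      by (intro mult_left_mono) (auto simp: K_def g_def)
    also have "\<dots> < e / 3"
      using close K by (simp add: g_def field_simps)
    finally show ?thesis .
  qed
  have "dilates_L1_Cauchy (schwarz u' \<circ> \<phi>)"
  proof (rule bounded_Re_dilates_L1_Cauchy[OF hol[OF u'(1)]])
    fix z :: complex assume z: "z \<in> ball 0 1"
    have "\<bar>Re (schwarz u' (\<phi> z))\<bar> \<le> Re (schwarz (\<lambda>_. B) (\<phi> z))"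
      by (intro abs_Re_schwarz_le u' \<phi>_in z integrable_angles_continuous continuous_on_const)
    then show "\<bar>Re ((schwarz u' \<circ> \<phi>) z)\<bar> \<le> B"
      by (simp add: schwarz_const[OF \<phi>_in[OF z]])
  qed
  then have "\<exists>R\<in>{0..<1}. \<forall>r\<in>{R..<1}. \<forall>s\<in>{R..<1}. (\<integral>\<theta>. \<bar>X u' r \<theta> - X u' s \<theta>\<bar> \<partial>angles) < e / 3"
    unfolding dilates_L1_Cauchy_def X_def by (rule allE[where x = "e / 3"]) (use \<open>e > 0\<close> in simp)
  then obtain R where R: "R \<in> {0..<1}"
    "\<And>r s. r \<in> {R..<1} \<Longrightarrow> s \<in> {R..<1} \<Longrightarrow> (\<integral>\<theta>. \<bar>X u' r \<theta> - X u' s \<theta>\<bar> \<partial>angles) < e / 3"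
    by blast
  show "\<exists>R\<in>{0..<1}. \<forall>r\<in>{R..<1}. \<forall>s\<in>{R..<1}.
    (\<integral>\<theta>. \<bar>Re ((schwarz u \<circ> \<phi>) (of_real r * cis \<theta>)) - Re ((schwarz u \<circ> \<phi>) (of_real s * cis \<theta>))\<bar> \<partial>angles) < e"
    unfolding X_def[symmetric]
  proof (intro bexI[OF _ R(1)] ballI)
    fix r s assume rs: "r \<in> {R..<1}" "s \<in> {R..<1}"
    then have rs': "r \<in> {0..<1}" "s \<in> {0..<1}" using R(1) by auto
    note i = X_int[OF u rs'(1)] X_int[OF u rs'(2)] X_int[OF u'(1) rs'(1)] X_int[OF u'(1) rs'(2)]
    have "(\<integral>\<theta>. \<bar>X u r \<theta> - X u s \<theta>\<bar> \<partial>angles)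
       \<le> (\<integral>\<theta>. \<bar>X u r \<theta> - X u' r \<theta>\<bar> + \<bar>X u' r \<theta> - X u' s \<theta>\<bar> + \<bar>X u s \<theta> - X u' s \<theta>\<bar> \<partial>angles)"
      using i by (intro integral_mono) auto
    also have "\<dots> = (\<integral>\<theta>. \<bar>X u r \<theta> - X u' r \<theta>\<bar> \<partial>angles) + (\<integral>\<theta>. \<bar>X u' r \<theta> - X u' s \<theta>\<bar> \<partial>angles)
         + (\<integral>\<theta>. \<bar>X u s \<theta> - X u' s \<theta>\<bar> \<partial>angles)"
      using i by simp
    also have "\<dots> < e"
      using compare[OF rs'(1)] compare[OF rs'(2)] R(2)[OF rs] by linarith
    finally show "(\<integral>\<theta>. \<bar>X u r \<theta> - X u s \<theta>\<bar> \<partial>angles) < e" .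
  qed
qed

section \<open>Outer functions as exponentials of Schwarz integrals\<close>

lemma set_integrable_angles_iff:
  fixes F :: "real \<Rightarrow> 'b :: {banach, second_countable_topology}"
  shows "set_integrable lebesgue {0..2 * pi} F \<longleftrightarrow> integrable angles F"
  by (simp add: integrable_restrict_space set_integrable_def)

lemma set_integral_angles:
  fixes F :: "real \<Rightarrow> 'b :: {banach, second_countable_topology}"
  shows "(LINT \<theta>:{0..2 * pi}|lebesgue. F \<theta>) = (\<integral>\<theta>. F \<theta> \<partial>angles)"
  by (simp add: integral_restrict_space set_lebesgue_integral_def)

text \<open>
  A density \<open>\<rho>\<close> on the circle carries the same information as \<open>v = ln \<circ> \<rho> \<circ> cis\<close> on the interval of
  angles, except that \<open>v\<close> may take different values at the endpoints 0 and \<open>2 \<pi>\<close>, which \<open>cis\<close>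
  identifies. In the direction from \<open>v\<close> to \<open>\<rho>\<close>, the value at \<open>2 \<pi>\<close> is lost,
  which changes no integral.
\<close>

lemma outer_iff_schwarz:
  "outer g \<longleftrightarrow> (\<exists>c v. norm c = 1 \<and> integrable angles v \<and>
     (\<forall>z\<in>ball 0 1. g z = c * exp (schwarz v z)))"
proof
  assume "outer g"
  then obtain c \<rho> where *: "norm c = 1" "set_integrable lebesgue {0..2 * pi} (\<lambda>\<theta>. ln (\<rho> (cis \<theta>)))"
    "\<And>z. z \<in> ball 0 1 \<Longrightarrow> g z = c * exp ((LINT \<theta>:{0..2 * pi}|lebesgue.
         (cis \<theta> + z) / (cis \<theta> - z) * of_real (ln (\<rho> (cis \<theta>)))) / (2 * pi))"
    unfolding outer_def by blast
  show "\<exists>c v. norm c = 1 \<and> integrable angles v \<and> (\<forall>z\<in>ball 0 1. g z = c * exp (schwarz v z))"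
  proof (intro exI conjI ballI)
    show "integrable angles (\<lambda>\<theta>. ln (\<rho> (cis \<theta>)))"
      using *(2) by (simp only: set_integrable_angles_iff)
    show "g z = c * exp (schwarz (\<lambda>\<theta>. ln (\<rho> (cis \<theta>))) z)" if "z \<in> ball 0 1" for z
      unfolding *(3)[OF that] schwarz_def set_integral_angles ..
  qed (rule *)
next
  assume "\<exists>c v. norm c = 1 \<and> integrable angles v \<and> (\<forall>z\<in>ball 0 1. g z = c * exp (schwarz v z))"
  then obtain c v where c: "norm c = 1" and v: "integrable angles v"
    and g: "\<And>z. z \<in> ball 0 1 \<Longrightarrow> g z = c * exp (schwarz v z)" by blast
  define \<rho> where "\<rho> \<zeta> = exp (v (Arg2pi \<zeta>))" for \<zeta>
  have null: "emeasure angles {2 * pi} = 0" "{2 * pi} \<in> sets angles"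
    by (auto simp: emeasure_restrict_space sets_restrict_space_iff)
  have eq: "v \<theta> = ln (\<rho> (cis \<theta>))" if "\<theta> \<in> space angles" "\<theta> \<notin> {2 * pi}" for \<theta>
  proof -
    have "Arg2pi (cis \<theta>) = \<theta>"
      using that by (intro Arg2pi_unique[of 1]) (auto simp: cis_conv_exp)
    then show ?thesis by (simp add: \<rho>_def)
  qed
  show "outer g"
    unfolding outer_def
  proof (intro conjI exI[of _ c] exI[of _ \<rho>] ballI)
    show "g holomorphic_on ball 0 1"
    proof (rule holomorphic_transform)
      show "(\<lambda>z. c * exp (schwarz v z)) holomorphic_on ball 0 1"
        by (intro holomorphic_intros schwarz_holomorphic v)
    qed (rule g[symmetric])
    show "norm c = 1" by (rule c)
    show "\<rho> \<zeta> > 0" for \<zeta> by (simp add: \<rho>_def)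
    have "integrable angles v \<longleftrightarrow> integrable angles (\<lambda>\<theta>. ln (\<rho> (cis \<theta>)))"
    proof (rule integrable_discrete_difference)
      show "countable {2 * pi}" by simp
    qed (use null in simp_all, rule eq, simp_all)
    with v show "set_integrable lebesgue {0..2 * pi} (\<lambda>\<theta>. ln (\<rho> (cis \<theta>)))"
      by (simp only: set_integrable_angles_iff)
    fix z :: complex assume z: "z \<in> ball 0 1"
    have "(\<integral>\<theta>. (cis \<theta> + z) / (cis \<theta> - z) * of_real (v \<theta>) \<partial>angles)
        = (\<integral>\<theta>. (cis \<theta> + z) / (cis \<theta> - z) * of_real (ln (\<rho> (cis \<theta>))) \<partial>angles)"
    proof (rule integral_discrete_difference)
      show "countable {2 * pi}" by simp
      show "(cis \<theta> + z) / (cis \<theta> - z) * of_real (v \<theta>) = (cis \<theta> + z) / (cis \<theta> - z) * of_real (ln (\<rho> (cis \<theta>)))"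
        if "\<theta> \<in> space angles" "\<theta> \<notin> {2 * pi}" for \<theta>
        using eq[OF that] by (simp only:)
    qed (use null in simp_all)
    then show "g z = c * exp ((LINT \<theta>:{0..2 * pi}|lebesgue.
         (cis \<theta> + z) / (cis \<theta> - z) * of_real (ln (\<rho> (cis \<theta>)))) / (2 * pi))"
      unfolding g[OF z] schwarz_def set_integral_angles by (simp only:)
  qed
qed

theorem corollary4:
  fixes f \<phi> :: "complex \<Rightarrow> complex"
  assumes "outer f"
    and "\<phi> holomorphic_on ball 0 1"
    and "\<phi> ` ball 0 1 \<subseteq> ball 0 1"
  shows "outer (f \<circ> \<phi>)"
proof -
  from assms(1) obtain c u where c: "norm c = 1" and u: "integrable angles u"
    and f: "\<And>z. z \<in> ball 0 1 \<Longrightarrow> f z = c * exp (schwarz u z)"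
    unfolding outer_iff_schwarz by blast
  define h where "h = schwarz u \<circ> \<phi>"
  have hol: "h holomorphic_on ball 0 1"
    unfolding h_def by (rule holomorphic_on_compose_gen[OF assms(2) schwarz_holomorphic[OF u] assms(3)])
  have cauchy: "dilates_L1_Cauchy h"
    unfolding h_def by (rule schwarz_compose_dilates_L1_Cauchy[OF u assms(2,3)])
  obtain v where v: "integrable angles v"
    and h: "\<And>z. z \<in> ball 0 1 \<Longrightarrow> h z = \<i> * Im (h 0) + schwarz v z"
    by (rule schwarz_representation[OF hol cauchy]) (rule that)
  show ?thesis
    unfolding outer_iff_schwarz
  proof (intro exI conjI ballI)
    show "norm (c * cis (Im (h 0))) = 1" using c by (simp add: norm_mult)
    show "integrable angles v" by (rule v)
    fix z :: complex assume z: "z \<in> ball 0 1"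
    have "(f \<circ> \<phi>) z = c * exp (h z)"
      using f[of "\<phi> z"] assms(3) z by (auto simp: h_def image_subset_iff)
    also have "\<dots> = c * cis (Im (h 0)) * exp (schwarz v z)"
      unfolding h[OF z] by (simp add: exp_add cis_conv_exp)
    finally show "(f \<circ> \<phi>) z = c * cis (Im (h 0)) * exp (schwarz v z)" .
  qed
qed

end
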